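(* Let $N\ge 1$, let $\Omega\subset\mathbb{R}^N$ be a bounded domain with a Lipschitz continuous boundary, and let $0<s<1$, $0<\alpha\le 1$, $T>0$. Let $u_0\in L^2(\Omega)$ and let $v$ be the unique strong solution of the backward system $$ \begin{cases} D_{t,T}^\alpha v+(-\Delta)^s v=0 & \text{in }(0,T)\times\Omega,\\ v=0 & \text{in }(0,T)\times(\mathbb{R}^N\setminus\Omega),\\ I_{t,T}^{1-\alpha}v(T,\cdot)=u_0 & \text{in }\Omega. \end{cases} $$ Let $\mathcal O\subseteq\mathbb{R}^N\setminus\Omega$ be an arbitrary non-empty open set. If $\mathcal N_s v=0$ in $(0,T)\times\mathcal O$, then $v=0$ in $(0,T)\times\Omega$.
   Context: Fractional Laplacian: $(-\Delta)^su(x)=C_{N,s}\,\mathrm{P.V.}\int_{\mathbb{R}^N}\frac{u(x)-u(y)}{|x-y|^{N+2s}}\,dy$, with $C_{N,s}=\frac{s2^{2s}\Gamma(\frac{2s+N}{2})}{\pi^{N/2}\Gamma(1-s)}$. Sobolev spaces: $W^{s,2}(\mathbb{R}^N)$ is the space of $u\in L^2(\mathbb{R}^N)$ with $\int_{\mathbb{R}^N}\int_{\mathbb{R}^N}\frac{|u(x)-u(y)|^2}{|x-y|^{N+2s}}\,dxdy<\infty$; $W_0^{s,2}(\overline\Omega)=\{u\in W^{s,2}(\mathbb{R}^N): u=0 \text{ in }\mathbb{R}^N\setminus\Omega\}$; $W^{-s,2}(\overline\Omega)$ is the dual of $W_0^{s,2}(\overline\Omega)$, and $\langle\cdot,\cdot\rangle$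 is the duality pairing. For $u\in W^{s,2}(\mathbb{R}^N)$, $(-\Delta)^su$ acts by $\langle(-\Delta)^su,w\rangle=\frac{C_{N,s}}{2}\int_{\mathbb{R}^N}\int_{\mathbb{R}^N}\frac{(u(x)-u(y))(w(x)-w(y))}{|x-y|^{N+2s}}\,dxdy$. Right Riemann-Liouville operators: for $\beta\in(0,1)$, $I_{t,T}^{\beta}f(t)=\frac{1}{\Gamma(\beta)}\int_t^T(\tau-t)^{\beta-1}f(\tau)\,d\tau$, and $I_{t,T}^0$ is the identity; $D_{t,T}^\alpha f=-\frac{d}{dt}\big(I_{t,T}^{1-\alpha}f\big)$ (so $D_{t,T}^1f=-\partial_tf$). Strong solution of the backward system: a function $v$ with $I_{t,T}^{1-\alpha}v\in C([0,T];L^2(\Omega))$, $D_{t,T}^\alpha v\in C((0,T);W^{-s,2}(\overline\Omega))$, with $v=0$ in $(0,T)\times(\mathbb{R}^N\setminus\Omega)$ (so $v(t,\cdot)\in W_0^{s,2}(\overline\Omega)$ for a.e. $t$), such that for a.e. $t\in(0,T)$ and every $w\in W_0^{s,2}(\overline\Omega)$ one has $\langle D_{t,T}^\alpha v,w\rangle+\langle(-\Delta)^sv,w\rangle=0$, and $I_{t,T}^{1-\alpha}v(T,\cdot)=u_0$ in $\Omega$. A unique strong solution exists for every $u_0\in L^2(\Omega)$, and $v(t,\cdot)\in W_0^{s,2}(\overline\Omega)$ for every $t\in[0,T)$. Nonlocal normal derivative: for $u\in W^{s,2}(\mathbb{R}^N)$, $\mathcal N_su(x)=C_{N,s}\int_\Omega\frac{u(x)-u(y)}{|x-y|^{N+2s}}\,dy$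 for $x\in\mathbb{R}^N\setminus\overline\Omega$; $\mathcal N_sv$ means $\mathcal N_s$ applied to $v(t,\cdot)$ for each $t$. *)

theory Defs
  imports "HOL-Analysis.Analysis"
begin

text \<open>
  The ambient space is an arbitrary Euclidean space \<open>'a\<close>, so that \<open>N = DIM('a) \<ge> 1\<close>.
  Elements of \<open>L\<^sup>2\<close> and of Sobolev spaces are represented by functions; equality of functions
  of the space variable is understood almost everywhere throughout.
\<close>

text \<open>
  Near each boundary point the set is the strict epigraph, in the direction \<open>e\<close>, of a Lipschitz
  function on the hyperplane orthogonal to \<open>e\<close>; \<open>x - (x \<bullet> e) *\<^sub>R e\<close> is the projection onto it.
\<close>

definition lipschitz_boundary :: "'a::euclidean_space set \<Rightarrow> bool" where
  "lipschitz_boundary \<Omega> \<longleftrightarrow>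
     (\<forall>x0\<in>frontier \<Omega>. \<exists>e r L \<phi>. norm e = 1 \<and> 0 < r \<and> L-lipschitz_on {z. z \<bullet> e = 0} \<phi> \<and>
        \<Omega> \<inter> ball x0 r = {x \<in> ball x0 r. \<phi> (x - (x \<bullet> e) *\<^sub>R e) < x \<bullet> e})"

definition L2 :: "'a::euclidean_space set \<Rightarrow> ('a \<Rightarrow> real) set" where
  "L2 A = {f. set_borel_measurable lebesgue A f \<and> set_integrable lebesgue A (\<lambda>x. (f x)\<^sup>2)}"

definition L2_norm :: "'a::euclidean_space set \<Rightarrow> ('a \<Rightarrow> real) \<Rightarrow> real" where
  "L2_norm A f = sqrt (LINT x:A|lebesgue. (f x)\<^sup>2)"

definition C_L2 :: "real set \<Rightarrow> 'a::euclidean_space set \<Rightarrow> (real \<Rightarrow> 'a \<Rightarrow> real) set" where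
  "C_L2 J A = {f. (\<forall>t\<in>J. f t \<in> L2 A) \<and>
     (\<forall>t\<in>J. ((\<lambda>r. L2_norm A (\<lambda>x. f r x - f t x)) \<longlongrightarrow> 0) (at t within J))}"

subsection \<open>The fractional Laplacian and fractional Sobolev spaces\<close>

definition frac_kernel :: "real \<Rightarrow> 'a::euclidean_space \<Rightarrow> 'a \<Rightarrow> real" where
  "frac_kernel s x y = 1 / norm (x - y) powr (real DIM('a) + 2 * s)"

definition frac_const :: "'a::euclidean_space itself \<Rightarrow> real \<Rightarrow> real" where
  "frac_const _ s =
     s * 2 powr (2 * s) * Gamma ((2 * s + real DIM('a)) / 2) /
     (pi powr (real DIM('a) / 2) * Gamma (1 - s))"

text \<open>Double integrals are taken with respect to Lebesgue measure on the product type \<open>'a \<times> 'a\<close>.\<close>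

definition frac_sobolev :: "real \<Rightarrow> ('a::euclidean_space \<Rightarrow> real) set" where
  "frac_sobolev s = {u \<in> L2 UNIV.
     integrable (lebesgue :: ('a \<times> 'a) measure) (\<lambda>(x, y). (u x - u y)\<^sup>2 * frac_kernel s x y)}"

definition frac_sobolev_norm :: "real \<Rightarrow> ('a::euclidean_space \<Rightarrow> real) \<Rightarrow> real" where
  "frac_sobolev_norm s u =
     sqrt ((LINT x|lebesgue. (u x)\<^sup>2) +
           (LINT p|(lebesgue :: ('a \<times> 'a) measure).
              (case p of (x, y) \<Rightarrow> (u x - u y)\<^sup>2 * frac_kernel s x y)))"

definition frac_sobolev0 :: "real \<Rightarrow> 'a::euclidean_space set \<Rightarrow> ('a \<Rightarrow> real) set" where
  "frac_sobolev0 s \<Omega> = {u \<in> frac_sobolev s. AE x in lebesgue. x \<notin> \<Omega> \<longrightarrow> u x = 0}"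

definition frac_laplacian ::
    "real \<Rightarrow> ('a::euclidean_space \<Rightarrow> real) \<Rightarrow> ('a \<Rightarrow> real) \<Rightarrow> real" where
  "frac_laplacian s u w = frac_const TYPE('a) s / 2 *
     (LINT p|(lebesgue :: ('a \<times> 'a) measure).
        (case p of (x, y) \<Rightarrow> (u x - u y) * (w x - w y) * frac_kernel s x y))"

text \<open>Only meaningful for \<open>x\<close> outside the closure of \<open>\<Omega>\<close>.\<close>

definition nonlocal_normal ::
    "real \<Rightarrow> 'a::euclidean_space set \<Rightarrow> ('a \<Rightarrow> real) \<Rightarrow> 'a \<Rightarrow> real" where
  "nonlocal_normal s \<Omega> u x = frac_const TYPE('a) s *
     (LINT y:\<Omega>|lebesgue. (u x - u y) * frac_kernel s x y)"

subsection \<open>The dual space\<close>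

text \<open>
  Functionals are only relevant on \<open>frac_sobolev0 s \<Omega>\<close>; boundedness makes them respect almost
  everywhere equality there. The \<open>L\<^sup>2\<close> functions embed via the \<open>L\<^sup>2\<close> pairing.
\<close>

definition frac_sobolev_dual ::
    "real \<Rightarrow> 'a::euclidean_space set \<Rightarrow> (('a \<Rightarrow> real) \<Rightarrow> real) set" where
  "frac_sobolev_dual s \<Omega> = {F.
     (\<forall>u\<in>frac_sobolev0 s \<Omega>. \<forall>w\<in>frac_sobolev0 s \<Omega>. \<forall>a b.
        F (\<lambda>x. a * u x + b * w x) = a * F u + b * F w) \<and>
     (\<exists>K. \<forall>w\<in>frac_sobolev0 s \<Omega>. \<bar>F w\<bar> \<le> K * frac_sobolev_norm s w)}"

definition dual_norm ::
    "real \<Rightarrow> 'a::euclidean_space set \<Rightarrow> (('a \<Rightarrow> real) \<Rightarrow> real) \<Rightarrow> real" where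
  "dual_norm s \<Omega> F = (SUP w\<in>{w \<in> frac_sobolev0 s \<Omega>. frac_sobolev_norm s w \<le> 1}. \<bar>F w\<bar>)"

definition C_dual ::
    "real set \<Rightarrow> real \<Rightarrow> 'a::euclidean_space set \<Rightarrow> (real \<Rightarrow> ('a \<Rightarrow> real) \<Rightarrow> real) set" where
  "C_dual J s \<Omega> = {F. (\<forall>t\<in>J. F t \<in> frac_sobolev_dual s \<Omega>) \<and>
     (\<forall>t\<in>J. ((\<lambda>r. dual_norm s \<Omega> (\<lambda>w. F r w - F t w)) \<longlongrightarrow> 0) (at t within J))}"

definition has_dual_derivative ::
    "real \<Rightarrow> 'a::euclidean_space set \<Rightarrow> (real \<Rightarrow> ('a \<Rightarrow> real) \<Rightarrow> real) \<Rightarrow>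
     (('a \<Rightarrow> real) \<Rightarrow> real) \<Rightarrow> real \<Rightarrow> bool" where
  "has_dual_derivative s \<Omega> F F' t \<longleftrightarrow>
     ((\<lambda>h. dual_norm s \<Omega> (\<lambda>w. (F (t + h) w - F t w) / h - F' w)) \<longlongrightarrow> 0) (at 0)"

definition L2_functional ::
    "'a::euclidean_space set \<Rightarrow> ('a \<Rightarrow> real) \<Rightarrow> ('a \<Rightarrow> real) \<Rightarrow> real" where
  "L2_functional \<Omega> f w = (LINT x:\<Omega>|lebesgue. f x * w x)"

subsection \<open>Right Riemann--Liouville operators\<close>

text \<open>
  Applied to \<open>v :: real \<Rightarrow> 'a \<Rightarrow> real\<close> at each point of space. For \<open>v\<close> jointly measurable and
  \<open>RL_integrable \<beta> T \<Omega> v t\<close> (i.e. the integrand is Bochner integrable with values in \<open>L\<^sup>2(\<Omega>)\<close>)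
  the pointwise integral below converges for almost every \<open>x \<in> \<Omega>\<close> and is the Bochner integral.
\<close>

definition RL_integral :: "real \<Rightarrow> real \<Rightarrow> (real \<Rightarrow> 'a \<Rightarrow> real) \<Rightarrow> real \<Rightarrow> 'a \<Rightarrow> real" where
  "RL_integral \<beta> T v t x =
     (if \<beta> = 0 then v t x
      else 1 / Gamma \<beta> * (LINT \<tau>:{t<..<T}|lebesgue. (\<tau> - t) powr (\<beta> - 1) * v \<tau> x))"

definition RL_integrable ::
    "real \<Rightarrow> real \<Rightarrow> 'a::euclidean_space set \<Rightarrow> (real \<Rightarrow> 'a \<Rightarrow> real) \<Rightarrow> real \<Rightarrow> bool" where
  "RL_integrable \<beta> T \<Omega> v t \<longleftrightarrow>
     \<beta> = 0 \<or> set_integrable lebesgue {t<..<T} (\<lambda>\<tau>. (\<tau> - t) powr (\<beta> - 1) * L2_norm \<Omega> (v \<tau>))"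

text \<open>
  \<open>has_RL_derivative s \<Omega> \<alpha> T v D t\<close> means that \<open>D\<^sub>t\<^sub>,\<^sub>T\<^sup>\<alpha> v(t) = D\<close>, the time derivative being taken
  in the norm of \<open>W\<^sup>-\<^sup>s\<^sup>,\<^sup>2\<close>.
\<close>

definition has_RL_derivative ::
    "real \<Rightarrow> 'a::euclidean_space set \<Rightarrow> real \<Rightarrow> real \<Rightarrow> (real \<Rightarrow> 'a \<Rightarrow> real) \<Rightarrow>
     (('a \<Rightarrow> real) \<Rightarrow> real) \<Rightarrow> real \<Rightarrow> bool" where
  "has_RL_derivative s \<Omega> \<alpha> T v D t \<longleftrightarrow>
     has_dual_derivative s \<Omega> (\<lambda>r. L2_functional \<Omega> (RL_integral (1 - \<alpha>) T v r)) (\<lambda>w. - D w) t"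

subsection \<open>Strong solutions of the backward system\<close>

text \<open>
  For \<open>\<alpha> < 1\<close> the integral defining \<open>RL_integral (1 - \<alpha>) T v T\<close> is over the empty set, so the
  terminal condition has to be read as a limit: the fractional integral on \<open>[0, T)\<close>, extended
  by \<open>u0\<close> at the time \<open>T\<close>, is continuous on \<open>[0, T]\<close> with values in \<open>L\<^sup>2(\<Omega>)\<close>. For \<open>\<alpha> = 1\<close> this is
  the usual terminal condition \<open>v(T) = u0\<close>. Joint measurability in \<open>(t, x)\<close> is how strong
  measurability of an \<open>L\<^sup>2(\<Omega>)\<close>-valued function of time is expressed for functions of two variables.
\<close>

definition strong_solution ::
    "real \<Rightarrow> real \<Rightarrow> real \<Rightarrow> 'a::euclidean_space set \<Rightarrow> ('a \<Rightarrow> real) \<Rightarrow>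
     (real \<Rightarrow> 'a \<Rightarrow> real) \<Rightarrow> bool" where
  "strong_solution s \<alpha> T \<Omega> u0 v \<longleftrightarrow>
     set_borel_measurable (lebesgue :: (real \<times> 'a) measure) ({0<..<T} \<times> UNIV) (\<lambda>(t, x). v t x) \<and>
     (\<forall>t\<in>{0<..<T}. v t \<in> L2 \<Omega>) \<and>
     (\<forall>t\<in>{0<..<T}. AE x in lebesgue. x \<notin> \<Omega> \<longrightarrow> v t x = 0) \<and>
     (\<forall>t\<in>{0..<T}. RL_integrable (1 - \<alpha>) T \<Omega> v t) \<and>
     (RL_integral (1 - \<alpha>) T v)(T := u0) \<in> C_L2 {0..T} \<Omega> \<and>
     (\<exists>D\<in>C_dual {0<..<T} s \<Omega>.
        (\<forall>t\<in>{0<..<T}. has_RL_derivative s \<Omega> \<alpha> T v (D t) t) \<and>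
        (AE t in lebesgue. t \<in> {0<..<T} \<longrightarrow>
           v t \<in> frac_sobolev0 s \<Omega> \<and>
           (\<forall>w\<in>frac_sobolev0 s \<Omega>. D t w + frac_laplacian s (v t) w = 0)))"

end

theory Submission
  imports Defs
begin

text \<open>
  At each fixed time the function \<open>f = v t\<close> is in \<open>L\<^sup>2(\<Omega>)\<close> and vanishes outside \<open>\<Omega>\<close>, so on the
  observation set its nonlocal normal derivative is a nonzero multiple of the potential
  \<open>\<integral>\<^sub>\<Omega> f(y) \<bar>x - y\<bar>\<^bsup>-(N + 2s)\<^esup> dy\<close>. The theorem is therefore a unique continuation property of Riesz
  potentials: if this potential vanishes for \<open>x\<close> in a non-empty open set \<open>B\<close> on which \<open>f\<close> is zero,
  then \<open>f = 0\<close> everywhere. The complement of \<open>\<Omega>\<close> may be disconnected, so analytic continuation of the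
  potential does not always lead from \<open>B\<close> to infinity; all observers \<open>x\<close> below are taken in \<open>B\<close>.

  Call a kernel \<open>K\<close> annihilated if \<open>\<integral> f(y) K(y - x) dy = 0\<close> for all \<open>x \<in> B\<close>. As \<open>B\<close> is open and \<open>f\<close>
  vanishes there, one may differentiate in \<open>x\<close> under the integral, so smooth annihilated kernels are
  closed under directional derivatives (\<open>annihilates_directional_derivative\<close>). The rest is a matter of
  producing enough kernels.

  \<^item> The Laplacian of \<open>\<bar>z\<bar>\<^bsup>-2a\<^esup>\<close> is \<open>2a(2a + 2 - N) \<bar>z\<bar>\<^bsup>-2(a + 1)\<^esup>\<close>. For \<open>a = N/2 + s + j\<close> the factor is never
    zero, so all the powers \<open>\<bar>z\<bar>\<^bsup>-N - 2s - 2j\<^esup>\<close>, \<open>j \<in> \<nat>\<close>, are annihilated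
    (\<open>annihilates_riesz_kernel_add\<close>).
  \<^item> For fixed \<open>x\<close> these are the moments of a measure in the variable \<open>\<bar>y - x\<bar>\<^bsup>-2\<^esup>\<close>, which ranges over a
    compact subset of \<open>(0, \<infinity>)\<close>. By the Weierstrass approximation theorem every continuous radial kernel
    is annihilated, in particular the Gaussian (\<open>annihilates_gaussian\<close>).
  \<^item> Differentiating the Gaussian again and again produces all polynomials times the Gaussian
    (\<open>annihilates_poly_gaussian\<close>).
  \<^item> So all polynomial moments of \<open>f(y) exp(-\<bar>y - x\<bar>\<^sup>2)\<close> vanish, and since \<open>f\<close> has bounded support, \<open>f = 0\<close>
    almost everywhere by the Stone--Weierstrass theorem (\<open>AE_eq_0_if_polynomial_moments_vanish\<close>).
\<close>

section \<open>Functions with vanishing polynomial moments\<close>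

text \<open>
  Uniform approximation of \<open>\<phi>\<close> on \<open>S\<close> by polynomials changes the integral by an arbitrarily small
  multiple of \<open>\<integral> \<bar>G\<bar>\<close>. The change of variable \<open>w\<close> allows the moments to be taken in another space: here
  in a radial variable as well as in the space itself.
\<close>

lemma integral_continuous_compose_eq_0:
  fixes G :: "'a::euclidean_space \<Rightarrow> real" and w :: "'a \<Rightarrow> 'b::euclidean_space"
  assumes G: "integrable lebesgue G" and w: "w \<in> borel_measurable lebesgue"
    and S: "compact S" "\<And>y. G y \<noteq> 0 \<Longrightarrow> w y \<in> S"
    and poly: "\<And>Q. real_polynomial_function Q \<Longrightarrow> (LINT y|lebesgue. G y * Q (w y)) = 0"
    and \<phi>: "continuous_on S \<phi>" "integrable lebesgue (\<lambda>y. G y * \<phi> (w y))"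
  shows "(LINT y|lebesgue. G y * \<phi> (w y)) = 0"
proof -
  define I where "I = (LINT y|lebesgue. G y * \<phi> (w y))"
  define J where "J = (LINT y|lebesgue. \<bar>G y\<bar>)"
  have J: "J \<ge> 0" unfolding J_def by simp
  have bound: "\<bar>I\<bar> \<le> e * J" if e: "e > 0" for e
  proof -
    obtain Q where Q: "real_polynomial_function Q" and approx: "\<And>z. z \<in> S \<Longrightarrow> \<bar>\<phi> z - Q z\<bar> < e"
      by (rule Stone_Weierstrass_real_polynomial_function[OF S(1) \<phi>(1) e]) blast
    have near: "\<bar>G y * \<phi> (w y) - G y * Q (w y)\<bar> \<le> e * \<bar>G y\<bar>" for y
    proof (cases "G y = 0")
      case False
      hence "\<bar>\<phi> (w y) - Q (w y)\<bar> \<le> e" using approx S(2) less_imp_le by blast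
      hence "\<bar>G y\<bar> * \<bar>\<phi> (w y) - Q (w y)\<bar> \<le> \<bar>G y\<bar> * e" by (rule mult_left_mono) simp
      thus ?thesis by (simp add: right_diff_distrib[symmetric] abs_mult mult.commute)
    qed simp
    have "continuous_on UNIV Q"
      using Q by (simp add: continuous_on_polymonial_function real_polynomial_function_eq)
    hence "(\<lambda>y. Q (w y)) \<in> borel_measurable lebesgue"
      using w by (intro measurable_compose[OF w] borel_measurable_continuous_onI)
    hence meas: "(\<lambda>y. G y * \<phi> (w y) - G y * Q (w y)) \<in> borel_measurable lebesgue"
      by (intro borel_measurable_diff borel_measurable_times[OF borel_measurable_integrable[OF G]]
        borel_measurable_integrable[OF \<phi>(2)])
    have int: "integrable lebesgue (\<lambda>y. G y * \<phi> (w y) - G y * Q (w y))"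
      by (rule Bochner_Integration.integrable_bound[OF _ meas, of "\<lambda>y. e * \<bar>G y\<bar>"])
        (use G near e in \<open>auto intro!: AE_I2 simp: abs_mult\<close>)
    have "integrable lebesgue (\<lambda>y. G y * Q (w y))"
      using Bochner_Integration.integrable_diff[OF \<phi>(2) int] by simp
    hence "I = (LINT y|lebesgue. G y * \<phi> (w y) - G y * Q (w y))"
      using poly[OF Q] \<phi>(2) by (simp add: I_def Bochner_Integration.integral_diff)
    also have "\<bar>\<dots>\<bar> \<le> (LINT y|lebesgue. e * \<bar>G y\<bar>)"
      by (rule integral_abs_bound_integral[OF int]) (use G near in auto)
    finally show ?thesis by (simp add: J_def)
  qed
  have "I = 0"
  proof (rule ccontr)
    assume "I \<noteq> 0"
    hence "\<bar>I\<bar> / (J + 1) > 0" using J by simp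
    from bound[OF this] have "\<bar>I\<bar> * (J + 1) \<le> \<bar>I\<bar> * J" using J by (simp add: divide_simps)
    thus False using \<open>I \<noteq> 0\<close> by (simp add: distrib_left)
  qed
  thus ?thesis by (simp add: I_def)
qed

text \<open>
  Testing \<open>G\<close> against continuous functions that converge almost everywhere to \<open>sgn G\<close> gives
  \<open>\<integral> \<bar>G\<bar> = 0\<close>.
\<close>

lemma AE_eq_0_if_polynomial_moments_vanish:
  fixes G :: "'a::euclidean_space \<Rightarrow> real"
  assumes G: "integrable lebesgue G" and bdd: "bounded {y. G y \<noteq> 0}"
    and poly: "\<And>Q. real_polynomial_function Q \<Longrightarrow> (LINT y|lebesgue. G y * Q y) = 0"
  shows "AE y in lebesgue. G y = 0"
proof -
  have Gm: "G \<in> borel_measurable lebesgue" using G by simp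
  have "(\<lambda>y. sgn (G y)) \<in> borel_measurable lebesgue"
    using Gm by (intro measurable_compose[OF Gm]) measurable
  hence "(\<lambda>y. sgn (G y)) \<in> borel_measurable (lebesgue_on UNIV)" by (simp add: lebesgue_on_UNIV_eq)
  hence "(\<lambda>y. sgn (G y)) measurable_on UNIV"
    by (simp add: measurable_on_iff_borel_measurable)
  then obtain N F where N: "negligible N" and F: "\<And>n. continuous_on UNIV (F n)"
    and lim: "\<And>y. y \<notin> N \<Longrightarrow> (\<lambda>n. F n y) \<longlonglongrightarrow> sgn (G y)"
    unfolding measurable_on_def by auto
  \<comment> \<open>Clipping keeps the limit, as \<open>\<bar>sgn\<bar> \<le> 1\<close>, and makes \<open>\<bar>G\<bar>\<close> a dominating function.\<close>
  define \<phi> where "\<phi> n y = max (-1) (min 1 (F n y))" for n :: nat and y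
  have \<phi>_cont: "continuous_on UNIV (\<phi> n)" for n
    unfolding \<phi>_def by (intro continuous_intros F)
  have \<phi>_bound: "\<bar>\<phi> n y\<bar> \<le> 1" for n y by (auto simp: \<phi>_def)
  have "\<phi> n \<in> borel_measurable lebesgue" for n
    using borel_measurable_continuous_onI[OF \<phi>_cont[of n]] by (simp add: measurable_completion)
  hence meas: "(\<lambda>y. G y * \<phi> n y) \<in> borel_measurable lebesgue" for n
    using Gm by (intro borel_measurable_times)
  have near: "norm (G y * \<phi> n y) \<le> \<bar>G y\<bar>" for n y
    using mult_left_mono[OF \<phi>_bound[of n y], of "\<bar>G y\<bar>"] by (simp add: abs_mult)
  have int: "integrable lebesgue (\<lambda>y. G y * \<phi> n y)" for n
    by (rule Bochner_Integration.integrable_bound[OF _ meas, of "\<lambda>y. \<bar>G y\<bar>"])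
       (use G near in \<open>auto intro!: AE_I2\<close>)
  obtain R where R: "\<And>y. G y \<noteq> 0 \<Longrightarrow> norm y \<le> R" using bdd by (auto simp: bounded_iff)
  have zero: "(LINT y|lebesgue. G y * \<phi> n y) = 0" for n
  proof (rule integral_continuous_compose_eq_0[where w = "\<lambda>y. y" and S = "cball 0 R", OF G])
    show "(\<lambda>y::'a. y) \<in> borel_measurable lebesgue" by (intro measurable_completion) simp
  qed (use R poly \<phi>_cont int in \<open>auto intro: continuous_on_subset\<close>)
  have "(\<lambda>n. LINT y|lebesgue. G y * \<phi> n y) \<longlonglongrightarrow> (LINT y|lebesgue. \<bar>G y\<bar>)"
  proof (rule integral_dominated_convergence)
    show "AE y in lebesgue. (\<lambda>n. G y * \<phi> n y) \<longlonglongrightarrow> \<bar>G y\<bar>"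
    proof (rule AE_I')
      show "N \<in> null_sets lebesgue" using N negligible_iff_null_sets by blast
      have "(\<lambda>n. G y * \<phi> n y) \<longlonglongrightarrow> \<bar>G y\<bar>" if "y \<notin> N" for y
      proof -
        have "(\<lambda>n. G y * \<phi> n y) \<longlonglongrightarrow> G y * max (-1) (min 1 (sgn (G y)))"
          unfolding \<phi>_def using lim[OF that] by (intro tendsto_intros)
        moreover have "G y * max (-1) (min 1 (sgn (G y))) = \<bar>G y\<bar>" by (simp add: sgn_if)
        ultimately show ?thesis by (simp only:)
      qed
      thus "{y \<in> space lebesgue. \<not> (\<lambda>n. G y * \<phi> n y) \<longlonglongrightarrow> \<bar>G y\<bar>} \<subseteq> N" by auto
    qed
    show "AE y in lebesgue. norm (G y * \<phi> n y) \<le> \<bar>G y\<bar>" for n using near by (intro AE_I2)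
  qed (use G Gm meas in auto)
  hence "(LINT y|lebesgue. \<bar>G y\<bar>) = 0"
    unfolding zero using LIMSEQ_unique tendsto_const by blast
  thus ?thesis
    using G by (subst (asm) integral_nonneg_eq_0_iff_AE) auto
qed

section \<open>Kernels annihilated by a source away from the observers\<close>

locale separated_source =
  fixes g :: "'a::euclidean_space \<Rightarrow> real" and B :: "'a set"
  assumes integrable_source: "integrable lebesgue g"
    and bounded_source: "bounded {y. g y \<noteq> 0}"
    and open_region: "open B"
    and source_vanishes: "\<And>x. x \<in> B \<Longrightarrow> g x = 0"
begin

text \<open>
  A kernel is a function of the displacement from the observer \<open>x\<close> to the source point \<open>y\<close>. As
  \<open>g\<close> vanishes at every observer, kernels may be singular at \<open>0\<close>; they will be continuous elsewhere.
\<close>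

definition annihilates :: "('a \<Rightarrow> real) \<Rightarrow> bool" where
  "annihilates K \<longleftrightarrow> (\<forall>x\<in>B. (LINT y|lebesgue. g y * K (y - x)) = 0)"

text \<open>
  Displacements from observers near \<open>x\<close> to the support of \<open>g\<close> stay in a fixed compact set that avoids the
  singularity of the kernels.
\<close>

lemma displacements_in_annulus:
  assumes "x \<in> B"
  obtains r R where "r > 0" "R > 0" "ball x r \<subseteq> B"
    "\<forall>x'\<in>ball x r. \<forall>y. g y \<noteq> 0 \<longrightarrow> y - x' \<in> cball 0 R - ball 0 r"
proof -
  obtain e where e: "e > 0" "ball x e \<subseteq> B"
    using open_region assms openE by blast
  obtain M where "M > 0" and M: "\<And>y. g y \<noteq> 0 \<Longrightarrow> norm y \<le> M"
    using bounded_source by (auto simp: bounded_pos)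
  show thesis
  proof (rule that[of "e/2" "M + norm x + e"])
    show "e/2 > 0" "M + norm x + e > 0"
      using e \<open>M > 0\<close> norm_ge_zero[of x] by linarith+
    show "ball x (e/2) \<subseteq> B" using e by (auto simp: subset_iff)
    show "\<forall>x'\<in>ball x (e/2). \<forall>y. g y \<noteq> 0 \<longrightarrow> y - x' \<in> cball 0 (M + norm x + e) - ball 0 (e/2)"
    proof (intro ballI allI impI)
      fix x' y assume x': "x' \<in> ball x (e/2)" and y: "g y \<noteq> 0"
      have "y \<notin> ball x e" using e y source_vanishes by blast
      hence 1: "norm (x - y) \<ge> e" by (simp add: dist_norm)
      have 2: "norm (x - x') < e/2" using x' by (simp add: dist_norm)
      have "norm (x - y) \<le> norm (x - x') + norm (y - x')"
        using norm_triangle_ineq4[of "x - x'" "y - x'"] by simp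
      moreover have "norm (y - x') \<le> norm y + (norm x + norm (x - x'))"
        using norm_triangle_ineq4[of y x'] norm_triangle_ineq4[of x "x - x'"] by simp
      ultimately have "e/2 \<le> norm (y - x')" "norm (y - x') \<le> M + norm x + e"
        using 1 2 M[OF y] norm_ge_zero[of "x - x'"] by linarith+
      thus "y - x' \<in> cball 0 (M + norm x + e) - ball 0 (e/2)" by simp
    qed
  qed
qed

lemma kernel_locally_bounded:
  fixes K :: "'a \<Rightarrow> real"
  assumes K: "continuous_on (- {0}) K" and x: "x \<in> B"
  obtains r M where "r > 0" "ball x r \<subseteq> B"
    "\<forall>x'\<in>ball x r. \<forall>y. g y \<noteq> 0 \<longrightarrow> \<bar>K (y - x')\<bar> \<le> M"
proof -
  obtain r R where r: "r > 0" and "R > 0" and sub: "ball x r \<subseteq> B"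
    and annulus: "\<forall>x'\<in>ball x r. \<forall>y. g y \<noteq> 0 \<longrightarrow> y - x' \<in> cball 0 R - ball 0 r"
    by (rule displacements_in_annulus[OF x])
  have "compact (cball 0 R - ball (0::'a) r)"
    by (simp add: compact_diff)
  moreover have "continuous_on (cball 0 R - ball 0 r) K"
    using K by (rule continuous_on_subset) (use r in auto)
  ultimately have "bounded (K ` (cball 0 R - ball 0 r))"
    using compact_continuous_image compact_imp_bounded by blast
  then obtain M where M: "\<forall>v\<in>K ` (cball 0 R - ball 0 r). \<bar>v\<bar> \<le> M"
    unfolding bounded_iff real_norm_def by blast
  have "\<forall>x'\<in>ball x r. \<forall>y. g y \<noteq> 0 \<longrightarrow> \<bar>K (y - x')\<bar> \<le> M"
    using annulus M by blast
  with r sub show thesis by (rule that)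
qed

lemma kernel_measurable:
  assumes "continuous_on (- {0}) K" "x \<in> B"
  shows "(\<lambda>y. g y * K (y - x)) \<in> borel_measurable lebesgue"
proof -
  define K' where "K' z = (if z \<in> - {0} then K z else 0)" for z :: 'a
  have "K' \<in> borel_measurable borel"
    unfolding K'_def by (rule borel_measurable_continuous_on_if) (use assms in \<open>auto intro: continuous_on_const\<close>)
  hence "(\<lambda>y. K' (y - x)) \<in> borel_measurable borel" by measurable
  hence "(\<lambda>y. K' (y - x)) \<in> borel_measurable lebesgue" by (simp add: measurable_completion)
  hence "(\<lambda>y. g y * K' (y - x)) \<in> borel_measurable lebesgue"
    using integrable_source by (intro borel_measurable_times) auto
  moreover have "(\<lambda>y. g y * K' (y - x)) = (\<lambda>y. g y * K (y - x))"
    using source_vanishes[OF assms(2)] by (auto simp: K'_def fun_eq_iff)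
  ultimately show ?thesis by simp
qed

lemma kernel_integrable:
  assumes K: "continuous_on (- {0}) K" and x: "x \<in> B"
  shows "integrable lebesgue (\<lambda>y. g y * K (y - x))"
proof -
  obtain r M where r: "r > 0" and r_sub: "ball x r \<subseteq> B"
    and "\<forall>x'\<in>ball x r. \<forall>y. g y \<noteq> 0 \<longrightarrow> \<bar>K (y - x')\<bar> \<le> M"
    by (rule kernel_locally_bounded[OF K x])
  note bound = this(3)[rule_format]
  show ?thesis
  proof (rule Bochner_Integration.integrable_bound)
    show "integrable lebesgue (\<lambda>y. M * g y)" using integrable_source by simp
    show "AE y in lebesgue. norm (g y * K (y - x)) \<le> norm (M * g y)"
    proof (rule AE_I2)
      fix y
      show "norm (g y * K (y - x)) \<le> norm (M * g y)"
      proof (cases "g y = 0")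
        case False
        hence "\<bar>K (y - x)\<bar> \<le> \<bar>M\<bar>" using bound[of x y] r by simp
        hence "\<bar>g y\<bar> * \<bar>K (y - x)\<bar> \<le> \<bar>g y\<bar> * \<bar>M\<bar>" by (rule mult_left_mono) simp
        thus ?thesis by (simp add: abs_mult mult.commute)
      qed simp
    qed
  qed (rule kernel_measurable[OF K x])
qed

lemma annihilates_add:
  assumes "continuous_on (- {0}) K" "continuous_on (- {0}) L" "annihilates K" "annihilates L"
  shows "annihilates (\<lambda>z. K z + L z)"
  using assms unfolding annihilates_def
  by (simp add: distrib_left Bochner_Integration.integral_add kernel_integrable)

lemma annihilates_scale: "annihilates K \<Longrightarrow> annihilates (\<lambda>z. c * K z)"
  by (simp add: annihilates_def mult.left_commute[of _ c])

lemma annihilates_sum: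
  assumes "\<And>i. i \<in> I \<Longrightarrow> continuous_on (- {0}) (K i)" "\<And>i. i \<in> I \<Longrightarrow> annihilates (K i)"
  shows "annihilates (\<lambda>z. \<Sum>i\<in>I. K i z)"
  using assms unfolding annihilates_def
  by (simp add: sum_distrib_left Bochner_Integration.integral_sum kernel_integrable)

lemma annihilates_cong:
  assumes "annihilates K" "\<And>z. z \<noteq> 0 \<Longrightarrow> K z = L z"
  shows "annihilates L"
  unfolding annihilates_def
proof
  fix x assume x: "x \<in> B"
  have "g y * L (y - x) = g y * K (y - x)" for y
    using assms(2)[of "y - x"] source_vanishes[OF x] by (cases "y = x") auto
  hence "(LINT y|lebesgue. g y * L (y - x)) = (LINT y|lebesgue. g y * K (y - x))"
    by (simp only:)
  thus "(LINT y|lebesgue. g y * L (y - x)) = 0"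
    using assms(1) x by (simp add: annihilates_def)
qed

text \<open>
  The potential of \<open>g\<close> is continuous on \<open>B\<close>, and the points of \<open>B\<close> where it vanishes are dense because
  their complement is a null set.
\<close>

lemma annihilates_if_AE:
  assumes "continuous_on (- {0}) K"
    and "AE x in lebesgue. x \<in> B \<longrightarrow> (LINT y|lebesgue. g y * K (y - x)) = 0"
  shows "annihilates K"
  unfolding annihilates_def
proof
  fix x assume x: "x \<in> B"
  obtain r M where r: "r > 0" and r_sub: "ball x r \<subseteq> B"
    and "\<forall>x'\<in>ball x r. \<forall>y. g y \<noteq> 0 \<longrightarrow> \<bar>K (y - x')\<bar> \<le> M"
    by (rule kernel_locally_bounded[OF assms(1) x])
  note bound = this(3)[rule_format]
  define U where "U x = (LINT y|lebesgue. g y * K (y - x))" for x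
  obtain N where N: "N \<in> null_sets lebesgue" "{x. \<not> (x \<in> B \<longrightarrow> U x = 0)} \<subseteq> N"
    using assms(2) unfolding U_def eventually_ae_filter by auto
  have "\<exists>x'. x' \<in> ball x (r / (real n + 1)) \<and> U x' = 0" for n
  proof (rule ccontr)
    assume *: "\<not> ?thesis"
    have "r / (real n + 1) \<le> r" using r by (simp add: divide_simps)
    hence sub: "ball x (r / (real n + 1)) \<subseteq> B"
      using r_sub by (meson order_trans subset_ball)
    hence "ball x (r / (real n + 1)) \<subseteq> N" using * N(2) by blast
    moreover have "negligible N" using N(1) negligible_iff_null_sets by blast
    ultimately have "negligible (ball x (r / (real n + 1)))" using negligible_subset by blast
    moreover have "r / (real n + 1) > 0" using r by simp
    ultimately show False using open_not_negligible[OF open_ball] centre_in_ball by blast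
  qed
  then obtain X where X: "\<And>n. X n \<in> ball x (r / (real n + 1))" and UX: "\<And>n. U (X n) = 0"
    by metis
  have Xr: "X n \<in> ball x r" for n
  proof -
    have "r / (real n + 1) \<le> r" using r by (simp add: divide_simps)
    thus ?thesis using X[of n] by auto
  qed
  have X_lim: "X \<longlonglongrightarrow> x"
  proof (rule LIM_zero_cancel, rule Lim_null_comparison[OF always_eventually])
    show "\<forall>n. norm (X n - x) \<le> r / (real n + 1)"
      using X by (auto simp: dist_norm norm_minus_commute intro: less_imp_le)
    show "(\<lambda>n. r / (real n + 1)) \<longlonglongrightarrow> 0"
      using LIMSEQ_Suc[OF lim_const_over_n[of r]] by (simp add: add.commute)
  qed
  have "(\<lambda>n. U (X n)) \<longlonglongrightarrow> U x"
    unfolding U_def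
  proof (rule integral_dominated_convergence)
    show "integrable lebesgue (\<lambda>y. M * \<bar>g y\<bar>)" using integrable_source by simp
    show "(\<lambda>y. g y * K (y - x)) \<in> borel_measurable lebesgue"
      by (rule kernel_measurable[OF assms(1) x])
    show "(\<lambda>y. g y * K (y - X n)) \<in> borel_measurable lebesgue" for n
      using Xr r_sub by (intro kernel_measurable[OF assms(1)]) blast
    show "AE y in lebesgue. (\<lambda>n. g y * K (y - X n)) \<longlonglongrightarrow> g y * K (y - x)"
    proof (rule AE_I2)
      fix y
      show "(\<lambda>n. g y * K (y - X n)) \<longlonglongrightarrow> g y * K (y - x)"
      proof (cases "g y = 0")
        case False
        hence "y - x \<in> - {0}" using source_vanishes[OF x] by auto
        hence "isCont K (y - x)"
          using assms(1) by (simp add: continuous_on_eq_continuous_at open_Compl)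
        thus ?thesis by (intro tendsto_intros isCont_tendsto_compose[of _ K] X_lim)
      qed simp
    qed
    show "AE y in lebesgue. norm (g y * K (y - X n)) \<le> M * \<bar>g y\<bar>" for n
    proof (rule AE_I2)
      fix y
      show "norm (g y * K (y - X n)) \<le> M * \<bar>g y\<bar>"
      proof (cases "g y = 0")
        case False
        have "\<bar>K (y - X n)\<bar> * \<bar>g y\<bar> \<le> M * \<bar>g y\<bar>"
          using bound[OF Xr False] by (rule mult_right_mono) simp
        thus ?thesis by (simp add: abs_mult mult.commute)
      qed simp
    qed
  qed
  thus "(LINT y|lebesgue. g y * K (y - x)) = 0"
    unfolding UX using LIMSEQ_unique tendsto_const unfolding U_def by blast
qed

text \<open>
  Differentiation under the integral. By the mean value theorem the difference quotients in direction
  \<open>h\<close> are values of \<open>K'\<close> at displacements from nearby observers, hence uniformly bounded, and dominated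
  convergence applies. The displacement is moved by \<open>+t h\<close> when the observer moves by \<open>-t h\<close>.
\<close>

lemma annihilates_directional_derivative:
  assumes K: "continuous_on (- {0}) K" and K': "continuous_on (- {0}) K'"
    and ann: "annihilates K"
    and deriv: "\<And>z t. z + t *\<^sub>R h \<noteq> 0 \<Longrightarrow>
      ((\<lambda>t. K (z + t *\<^sub>R h)) has_real_derivative K' (z + t *\<^sub>R h)) (at t)"
  shows "annihilates K'"
  unfolding annihilates_def
proof
  fix x assume x: "x \<in> B"
  obtain r M where r: "r > 0" and r_sub: "ball x r \<subseteq> B"
    and "\<forall>x'\<in>ball x r. \<forall>y. g y \<noteq> 0 \<longrightarrow> \<bar>K' (y - x')\<bar> \<le> M"
    by (rule kernel_locally_bounded[OF K' x])
  note bound = this(3)[rule_format]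
  \<comment> \<open>Steps of length at most \<open>c\<close> keep the observer in the ball; the \<open>+ 1\<close> covers \<open>h = 0\<close>.\<close>
  define c where "c = r / (norm h + 1)"
  have c: "c > 0" unfolding c_def using r by (intro divide_pos_pos) (auto intro: add_nonneg_pos)
  have in_ball: "x - t *\<^sub>R h \<in> ball x r" if "0 \<le> t" "t \<le> c" for t
  proof -
    have "t * norm h \<le> c * norm h" using that by (simp add: mult_right_mono)
    also have "\<dots> < c * (norm h + 1)" using c by simp
    also have "\<dots> = r" unfolding c_def by (simp add: add_nonneg_eq_0_iff)
    finally show ?thesis using that by (simp add: dist_norm)
  qed
  define t where "t n = c / (real n + 1)" for n
  have t: "0 < t n" "t n \<le> c" for n
    using c by (auto simp: t_def divide_simps)
  have t_lim: "t \<longlonglongrightarrow> 0"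
    unfolding t_def using LIMSEQ_Suc[OF lim_const_over_n[of c]] by (simp add: add.commute)
  define q where "q n y = g y * ((K (y - x + t n *\<^sub>R h) - K (y - x)) / t n)" for n y
  have q_eq: "q n y = (g y * K (y - (x - t n *\<^sub>R h)) - g y * K (y - x)) / t n" for n y
    by (simp add: q_def algebra_simps diff_divide_distrib)
  have int1: "integrable lebesgue (\<lambda>y. g y * K (y - (x - t n *\<^sub>R h)))" for n
    using in_ball[of "t n"] t[of n] r_sub by (intro kernel_integrable K) auto
  have q0: "(LINT y|lebesgue. q n y) = 0" for n
  proof -
    have "x - t n *\<^sub>R h \<in> B" using in_ball[of "t n"] t[of n] r_sub by auto
    hence "(LINT y|lebesgue. g y * K (y - (x - t n *\<^sub>R h))) = 0"
      "(LINT y|lebesgue. g y * K (y - x)) = 0" 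
      using ann x unfolding annihilates_def by blast+
    thus ?thesis unfolding q_eq
      using int1[of n] kernel_integrable[OF K x] by (simp add: Bochner_Integration.integral_diff)
  qed
  have "(\<lambda>n. LINT y|lebesgue. q n y) \<longlonglongrightarrow> (LINT y|lebesgue. g y * K' (y - x))"
  proof (rule integral_dominated_convergence)
    show "integrable lebesgue (\<lambda>y. M * \<bar>g y\<bar>)" using integrable_source by simp
    show "(\<lambda>y. g y * K' (y - x)) \<in> borel_measurable lebesgue"
      by (rule kernel_measurable[OF K' x])
    show "q n \<in> borel_measurable lebesgue" for n
      unfolding q_eq[abs_def] using int1[of n] kernel_integrable[OF K x] by simp
    show "AE y in lebesgue. (\<lambda>n. q n y) \<longlonglongrightarrow> g y * K' (y - x)"
    proof (rule AE_I2)
      fix y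
      show "(\<lambda>n. q n y) \<longlonglongrightarrow> g y * K' (y - x)"
      proof (cases "g y = 0")
        case False
        hence "y - x \<noteq> 0" using source_vanishes[OF x] by auto
        hence "((\<lambda>t. K (y - x + t *\<^sub>R h)) has_real_derivative K' (y - x)) (at 0)"
          using deriv[of "y - x" 0] by simp
        hence "((\<lambda>t. (K (y - x + t *\<^sub>R h) - K (y - x)) / t) \<longlongrightarrow> K' (y - x)) (at 0)"
          by (simp add: DERIV_def)
        moreover have "filterlim t (at 0) sequentially"
          using t_lim t(1) by (auto simp: filterlim_at less_imp_neq[symmetric] intro!: always_eventually dest: less_imp_neq)
        ultimately have "(\<lambda>n. (K (y - x + t n *\<^sub>R h) - K (y - x)) / t n) \<longlonglongrightarrow> K' (y - x)"
          by (rule filterlim_compose)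
        thus ?thesis unfolding q_def by (intro tendsto_intros)
      qed (simp add: q_def)
    qed
    show "AE y in lebesgue. norm (q n y) \<le> M * \<bar>g y\<bar>" for n
    proof (rule AE_I2)
      fix y
      show "norm (q n y) \<le> M * \<bar>g y\<bar>"
      proof (cases "g y = 0")
        case False
        have x_u: "x - u *\<^sub>R h \<in> ball x r" if "0 \<le> u" "u \<le> t n" for u
          using in_ball[of u] that t(2)[of n] by simp
        have shift: "y - x + u *\<^sub>R h = y - (x - u *\<^sub>R h)" for u
          by simp
        have "\<exists>u. 0 < u \<and> u < t n \<and> K (y - x + t n *\<^sub>R h) - K (y - x + 0 *\<^sub>R h)
               = (t n - 0) * K' (y - x + u *\<^sub>R h)"
        proof (rule MVT2[OF t(1)])
          fix u assume "0 \<le> u" "u \<le> t n"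
          hence "x - u *\<^sub>R h \<in> B" using x_u r_sub by blast
          hence "y \<noteq> x - u *\<^sub>R h" using source_vanishes False by blast
          thus "((\<lambda>u. K (y - x + u *\<^sub>R h)) has_real_derivative K' (y - x + u *\<^sub>R h)) (at u)"
            by (intro deriv) (simp only: shift right_minus_eq not_False_eq_True)
        qed
        then obtain u where u: "0 < u" "u < t n"
          "K (y - x + t n *\<^sub>R h) - K (y - x) = t n * K' (y - x + u *\<^sub>R h)" by auto
        have "q n y = g y * K' (y - x + u *\<^sub>R h)"
          unfolding q_def u(3) using t(1)[of n] by simp
        moreover have "\<bar>K' (y - x + u *\<^sub>R h)\<bar> * \<bar>g y\<bar> \<le> M * \<bar>g y\<bar>"
          using bound[OF x_u[of u] False] u unfolding shift by (intro mult_right_mono) auto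
        ultimately show ?thesis by (simp add: abs_mult mult.commute)
      qed (simp add: q_def)
    qed
  qed
  thus "(LINT y|lebesgue. g y * K' (y - x)) = 0"
    unfolding q0 using LIMSEQ_unique tendsto_const by blast
qed

end

section \<open>From Riesz kernels to the Gaussian\<close>

lemma radial_directional_derivative:
  assumes "((\<lambda>t. P (z + t *\<^sub>R h)) has_real_derivative P') (at t)"
    and "(\<rho> has_real_derivative \<rho>') (at ((z + t *\<^sub>R h) \<bullet> (z + t *\<^sub>R h)))"
  shows "((\<lambda>t. P (z + t *\<^sub>R h) * \<rho> ((z + t *\<^sub>R h) \<bullet> (z + t *\<^sub>R h))) has_real_derivative
    P' * \<rho> ((z + t *\<^sub>R h) \<bullet> (z + t *\<^sub>R h))
    + 2 * (((z + t *\<^sub>R h) \<bullet> h) * P (z + t *\<^sub>R h)) * \<rho>') (at t)"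
proof -
  have "((\<lambda>t. (z + t *\<^sub>R h) \<bullet> (z + t *\<^sub>R h)) has_real_derivative 2 * ((z + t *\<^sub>R h) \<bullet> h)) (at t)"
    unfolding inner_add_left inner_scaleR_left inner_add_right inner_scaleR_right
    by (rule derivative_eq_intros refl | simp add: algebra_simps inner_commute)+
  from DERIV_chain2[OF assms(2) this]
  show ?thesis by (rule DERIV_cong[OF DERIV_mult[OF assms(1)]]) (simp add: algebra_simps)
qed

context separated_source
begin

abbreviation riesz_kernel :: "real \<Rightarrow> 'a \<Rightarrow> real" where
  "riesz_kernel a z \<equiv> (z \<bullet> z) powr (- a)"

text \<open>
  The sum of the second derivatives in the basis directions is the Laplacian, which raises the exponent
  by one and multiplies by \<open>2a(2(a + 1) - N)\<close>.
\<close>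

lemma annihilates_riesz_kernel_Suc:
  assumes a: "a > 0" "2 * (a + 1) \<noteq> real DIM('a)" and ann: "annihilates (riesz_kernel a)"
  shows "annihilates (riesz_kernel (a + 1))"
proof -
  have cont: "continuous_on (- {0}) (riesz_kernel b)" for b
    by (intro continuous_intros) auto
  \<comment> \<open>The first and second derivatives of the kernel in direction \<open>h\<close>.\<close>
  define D1 where "D1 h z = (z \<bullet> h) * ((-2 * a) * (z \<bullet> z) powr (- a - 1))" for h z :: 'a
  define D2 where "D2 h z = (h \<bullet> h) * ((-2 * a) * (z \<bullet> z) powr (- a - 1))
      + 2 * ((z \<bullet> h) * (z \<bullet> h)) * ((-2 * a) * ((- a - 1) * (z \<bullet> z) powr (- a - 1 - 1)))" for h z :: 'a
  have power: "((\<lambda>u. u powr b) has_real_derivative b * u powr (b - 1)) (at u)" if "u > 0" for b u :: real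
    using that by (rule has_real_derivative_powr)
  have ann1: "annihilates (D1 h)" for h
  proof (rule annihilates_directional_derivative[OF cont _ ann])
    show "continuous_on (- {0}) (D1 h)"
      unfolding D1_def by (intro continuous_intros) auto
    fix z :: 'a and t :: real assume "z + t *\<^sub>R h \<noteq> 0"
    from power[of "(z + t *\<^sub>R h) \<bullet> (z + t *\<^sub>R h)" "- a"] this
    have "((\<lambda>u. u powr - a) has_real_derivative - a * ((z + t *\<^sub>R h) \<bullet> (z + t *\<^sub>R h)) powr (- a - 1))
      (at ((z + t *\<^sub>R h) \<bullet> (z + t *\<^sub>R h)))" by simp
    from radial_directional_derivative[OF DERIV_const[of 1] this]
    show "((\<lambda>t. riesz_kernel a (z + t *\<^sub>R h)) has_real_derivative D1 h (z + t *\<^sub>R h)) (at t)"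
      by (simp add: D1_def mult_ac)
  qed
  have cont2: "continuous_on (- {0}) (D2 h)" for h
    unfolding D2_def by (intro continuous_intros) auto
  have ann2: "annihilates (D2 h)" for h
  proof (rule annihilates_directional_derivative[OF _ cont2 ann1])
    show "continuous_on (- {0}) (D1 h)"
      unfolding D1_def by (intro continuous_intros) auto
    fix z :: 'a and t :: real assume "z + t *\<^sub>R h \<noteq> 0"
    hence "((\<lambda>u. (-2 * a) * u powr (- a - 1)) has_real_derivative
        (-2 * a) * ((- a - 1) * ((z + t *\<^sub>R h) \<bullet> (z + t *\<^sub>R h)) powr (- a - 1 - 1)))
      (at ((z + t *\<^sub>R h) \<bullet> (z + t *\<^sub>R h)))"
      by (intro DERIV_cmult power) simp
    moreover have "((\<lambda>t. (z + t *\<^sub>R h) \<bullet> h) has_real_derivative h \<bullet> h) (at t)"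
      unfolding inner_add_left inner_scaleR_left by (rule derivative_eq_intros refl | simp)+
    ultimately show "((\<lambda>t. D1 h (z + t *\<^sub>R h)) has_real_derivative D2 h (z + t *\<^sub>R h)) (at t)"
      unfolding D1_def D2_def by (rule radial_directional_derivative[rotated])
  qed
  have laplacian: "(\<Sum>h\<in>Basis. D2 h z) = 2 * a * (2 * (a + 1) - real DIM('a)) * riesz_kernel (a + 1) z"
    if "z \<noteq> 0" for z
  proof -
    have "(\<Sum>h\<in>Basis. (z \<bullet> h) * (z \<bullet> h)) = z \<bullet> z" by (rule euclidean_inner[symmetric])
    moreover have "(\<Sum>h\<in>(Basis :: 'a set). h \<bullet> h) = real DIM('a)" by (simp add: inner_same_Basis)
    ultimately have "(\<Sum>h\<in>Basis. D2 h z) = real DIM('a) * ((-2 * a) * (z \<bullet> z) powr (- a - 1))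
      + 2 * (z \<bullet> z) * ((-2 * a) * ((- a - 1) * (z \<bullet> z) powr (- a - 1 - 1)))"
      unfolding D2_def sum.distrib sum_distrib_right[symmetric] sum_distrib_left[symmetric] by simp
    also have power_step: "(z \<bullet> z) powr (- a - 1) = (z \<bullet> z) * (z \<bullet> z) powr (- a - 1 - 1)"
    proof -
      have "(z \<bullet> z) * (z \<bullet> z) powr (- a - 1 - 1) = (z \<bullet> z) powr (1 + (- a - 1 - 1))"
        by (rule powr_mult_base) simp
      moreover have "1 + (- a - 1 - 1) = - a - 1" by simp
      ultimately show ?thesis by (simp only:)
    qed
    finally have "(\<Sum>h\<in>Basis. D2 h z)
        = 2 * a * (2 * (a + 1) - real DIM('a)) * ((z \<bullet> z) * (z \<bullet> z) powr (- a - 1 - 1))"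
      by (simp add: algebra_simps)
    also have "(z \<bullet> z) * (z \<bullet> z) powr (- a - 1 - 1) = riesz_kernel (a + 1) z"
    proof -
      have "- (a + 1) = - a - 1" by simp
      thus ?thesis using power_step by (simp only:)
    qed
    finally show ?thesis .
  qed
  define c where "c = 2 * a * (2 * (a + 1) - real DIM('a))"
  have "c \<noteq> 0" using a by (simp add: c_def)
  have "annihilates (\<lambda>z. (1 / c) * (\<Sum>h\<in>Basis. D2 h z))"
    by (intro annihilates_scale annihilates_sum cont2 ann2)
  thus ?thesis
    by (rule annihilates_cong) (use \<open>c \<noteq> 0\<close> laplacian c_def in simp)
qed

lemma annihilates_riesz_kernel_add:
  assumes a: "a > 0" "2 * (a + 1) > real DIM('a)" and ann: "annihilates (riesz_kernel a)"
  shows "annihilates (riesz_kernel (a + real j))"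
proof (induction j)
  case (Suc j)
  have "annihilates (riesz_kernel (a + real j + 1))"
    by (rule annihilates_riesz_kernel_Suc[OF _ _ Suc]) (use a in auto)
  thus ?case by (simp add: algebra_simps)
qed (use ann in simp)

text \<open>
  For a fixed observer, \<open>riesz_kernel (a + i) = riesz_kernel a \<cdot> u\<^sup>i\<close> with \<open>u = \<bar>z\<bar>\<^bsup>-2\<^esup>\<close>, so the measure with density
  \<open>G = g \<cdot> riesz_kernel a\<close> has vanishing moments in \<open>u\<close>. The Gaussian is a continuous function of \<open>u\<close> on
  the compact range of \<open>u\<close>, also after division by \<open>riesz_kernel a = u\<^bsup>a\<^esup>\<close>.
\<close>

lemma annihilates_gaussian:
  assumes ann: "\<And>j. annihilates (riesz_kernel (a + real j))"
  shows "annihilates (\<lambda>z. exp (- (z \<bullet> z)))"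
  unfolding annihilates_def
proof
  fix x assume x: "x \<in> B"
  obtain r R where r: "r > 0" and R: "R > 0" and r_sub: "ball x r \<subseteq> B"
    and "\<forall>x'\<in>ball x r. \<forall>y. g y \<noteq> 0 \<longrightarrow> y - x' \<in> cball 0 R - ball 0 r"
    by (rule displacements_in_annulus[OF x])
  note annulus = this(4)[rule_format]
  define G where "G y = g y * riesz_kernel a (y - x)" for y
  define w where "w y = inverse ((y - x) \<bullet> (y - x))" for y
  define \<phi> where "\<phi> u = u powr (- a) * exp (- inverse u)" for u :: real
  have cont: "continuous_on (- {0}) (riesz_kernel b)" for b
    by (intro continuous_intros) auto
  have G_nz: "g y \<noteq> 0 \<and> y \<noteq> x" if "G y \<noteq> 0" for y
    using that by (auto simp: G_def)
  have eq: "G y * \<phi> (w y) = g y * exp (- ((y - x) \<bullet> (y - x)))" for y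
  proof (cases "y = x")
    case False
    hence "(y - x) \<bullet> (y - x) > 0" by simp
    hence "riesz_kernel a (y - x) * w y powr (- a) = 1"
      unfolding w_def by (simp add: powr_minus inverse_powr)
    thus ?thesis by (simp add: G_def \<phi>_def w_def mult.assoc[symmetric])
  qed (use source_vanishes[OF x] in \<open>simp add: G_def\<close>)
  have "(LINT y|lebesgue. G y * \<phi> (w y)) = 0"
  proof (rule integral_continuous_compose_eq_0[where S = "{inverse (R\<^sup>2)..inverse (r\<^sup>2)}" and w = w and \<phi> = \<phi>])
    show G: "integrable lebesgue G"
      unfolding G_def by (rule kernel_integrable[OF cont x])
    show "w \<in> borel_measurable lebesgue"
      unfolding w_def by (intro measurable_completion) measurable
    show "compact {inverse (R\<^sup>2)..inverse (r\<^sup>2)}" by simp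
    show "w y \<in> {inverse (R\<^sup>2)..inverse (r\<^sup>2)}" if "G y \<noteq> 0" for y
    proof -
      have "y - x \<in> cball 0 R - ball 0 r" using annulus[of x y] G_nz[OF that] r by simp
      hence "r \<le> norm (y - x)" "norm (y - x) \<le> R" by auto
      hence "r\<^sup>2 \<le> (norm (y - x))\<^sup>2" "(norm (y - x))\<^sup>2 \<le> R\<^sup>2" "0 < (norm (y - x))\<^sup>2"
        using r by (auto intro: power_mono)
      thus ?thesis
        unfolding w_def power2_norm_eq_inner[symmetric] using r by (auto intro!: le_imp_inverse_le)
    qed
    show "(LINT y|lebesgue. G y * Q (w y)) = 0" if Q_poly: "real_polynomial_function Q" for Q
    proof -
      obtain b n where Q: "Q = (\<lambda>u. \<Sum>i\<le>n. b i * u ^ i)"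
        using Q_poly unfolding real_polynomial_function_iff_sum by blast
      have pw: "G y * Q (w y) = (\<Sum>i\<le>n. b i * (g y * riesz_kernel (a + real i) (y - x)))" for y
      proof (cases "y = x")
        case False
        hence pos: "(y - x) \<bullet> (y - x) > 0" by simp
        have "riesz_kernel (a + real i) (y - x) = riesz_kernel a (y - x) * w y ^ i" for i
          using pos by (simp add: w_def powr_diff powr_realpow power_inverse divide_inverse)
        thus ?thesis by (simp add: G_def Q sum_distrib_left mult_ac)
      qed (use source_vanishes[OF x] in \<open>simp add: G_def\<close>)
      have "(LINT y|lebesgue. (\<Sum>i\<le>n. b i * (g y * riesz_kernel (a + real i) (y - x))))
         = (\<Sum>i\<le>n. LINT y|lebesgue. b i * (g y * riesz_kernel (a + real i) (y - x)))"
        by (intro Bochner_Integration.integral_sum integrable_mult_right kernel_integrable[OF cont x])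
      also have "\<dots> = 0"
        using ann x unfolding annihilates_def by simp
      finally show ?thesis unfolding pw .
    qed
    show "integrable lebesgue (\<lambda>y. G y * \<phi> (w y))"
      unfolding eq by (rule kernel_integrable[OF _ x]) (intro continuous_intros)
    show "continuous_on {inverse (R\<^sup>2)..inverse (r\<^sup>2)} \<phi>"
    proof -
      have "inverse (R\<^sup>2) > 0" using R by simp
      hence "u \<noteq> 0" if "u \<in> {inverse (R\<^sup>2)..inverse (r\<^sup>2)}" for u
        using that by (auto simp del: inverse_positive_iff_positive)
      thus ?thesis unfolding \<phi>_def by (intro continuous_intros) blast+
    qed
  qed
  thus "(LINT y|lebesgue. g y * exp (- ((y - x) \<bullet> (y - x)))) = 0" unfolding eq .
qed

end

section \<open>From the Gaussian to all polynomials\<close>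

text \<open>
  The polynomial functions of degree at most \<open>m\<close>, generated so that an induction on the degree only has
  to treat multiplication by one linear form at a time. For \<open>m = 0\<close> only constants arise.
\<close>

inductive poly_le :: "nat \<Rightarrow> ('a::euclidean_space \<Rightarrow> real) \<Rightarrow> bool" where
  const: "poly_le m (\<lambda>z. c)"
| add: "poly_le m P \<Longrightarrow> poly_le m Q \<Longrightarrow> poly_le m (\<lambda>z. P z + Q z)"
| times: "poly_le m P \<Longrightarrow> poly_le (Suc m) (\<lambda>z. (z \<bullet> h) * P z)"

lemma poly_le_Suc: "poly_le m P \<Longrightarrow> poly_le (Suc m) P"
  by (induction rule: poly_le.induct) (auto intro: poly_le.intros)

lemma poly_le_mono: "m \<le> n \<Longrightarrow> poly_le m P \<Longrightarrow> poly_le n P"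
  by (induction n rule: dec_induct) (auto intro: poly_le_Suc)

lemma poly_le_scale: "poly_le m P \<Longrightarrow> poly_le m (\<lambda>z. c * P z)"
proof (induction rule: poly_le.induct)
  case (add m P Q)
  thus ?case using poly_le.add[OF add.IH] by (simp add: distrib_left)
next
  case (times m P h)
  thus ?case using poly_le.times[OF times.IH, of h] by (simp add: mult.left_commute)
qed (rule poly_le.const)

lemma poly_le_mult: "poly_le m P \<Longrightarrow> poly_le n Q \<Longrightarrow> poly_le (m + n) (\<lambda>z. P z * Q z)"
proof (induction rule: poly_le.induct)
  case (const m c)
  hence "poly_le (m + n) Q" by (rule poly_le_mono[rotated]) simp
  thus ?case by (rule poly_le_scale)
next
  case (add m P P')
  thus ?case using poly_le.add[OF add.IH] by (simp add: distrib_right)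
next
  case (times m P h)
  thus ?case using poly_le.times[OF times.IH, of h] by (simp add: mult.assoc)
qed

lemma real_polynomial_function_imp_poly_le:
  assumes "real_polynomial_function (Q :: 'a::euclidean_space \<Rightarrow> real)"
  shows "\<exists>m. poly_le m Q"
  using assms
proof (induction rule: real_polynomial_function.induct)
  case (linear f)
  then interpret f: bounded_linear f .
  have "f = (\<lambda>z. (z \<bullet> adjoint f 1) * 1)"
    using adjoint_works[OF f.linear_axioms, of _ 1] by (simp add: fun_eq_iff inner_commute)
  thus ?case using poly_le.times[OF poly_le.const, of 0 "adjoint f 1" 1] by metis
next
  case (add P Q)
  then obtain m n where "poly_le m P" "poly_le n Q" by blast
  hence "poly_le (max m n) P" "poly_le (max m n) Q" by (auto intro: poly_le_mono[rotated])
  thus ?case using poly_le.add by blast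
qed (use poly_le.const poly_le_mult in blast)+

lemma poly_le_continuous: "poly_le m P \<Longrightarrow> continuous_on S P"
  by (induction rule: poly_le.induct) (auto intro!: continuous_intros)

text \<open>
  Keeping the bound \<open>m\<close> for the derivative, instead of lowering it, avoids a separate case for constants.
\<close>

lemma poly_le_directional_derivative:
  assumes "poly_le m P"
  shows "\<exists>P'. poly_le m P' \<and>
    (\<forall>z t. ((\<lambda>t. P (z + t *\<^sub>R h)) has_real_derivative P' (z + t *\<^sub>R h)) (at t))"
  using assms
proof (induction rule: poly_le.induct)
  case (const m c)
  show ?case by (rule exI[of _ "\<lambda>_. 0"]) (auto intro: poly_le.const)
next
  case (add m P Q)
  then obtain P' Q' where "poly_le m P'" "poly_le m Q'"
    "\<And>z t. ((\<lambda>t. P (z + t *\<^sub>R h)) has_real_derivative P' (z + t *\<^sub>R h)) (at t)"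
    "\<And>z t. ((\<lambda>t. Q (z + t *\<^sub>R h)) has_real_derivative Q' (z + t *\<^sub>R h)) (at t)"
    by blast
  thus ?case by (intro exI[of _ "\<lambda>z. P' z + Q' z"]) (auto intro: poly_le.add DERIV_add)
next
  case (times m P e)
  then obtain P' where P': "poly_le m P'"
    "\<And>z t. ((\<lambda>t. P (z + t *\<^sub>R h)) has_real_derivative P' (z + t *\<^sub>R h)) (at t)"
    by blast
  have "poly_le (Suc m) (\<lambda>z. (h \<bullet> e) * P z + (z \<bullet> e) * P' z)"
    using times P' by (intro poly_le.add poly_le_scale poly_le_Suc poly_le.times)
  moreover have "((\<lambda>t. ((z + t *\<^sub>R h) \<bullet> e) * P (z + t *\<^sub>R h)) has_real_derivative
    (h \<bullet> e) * P (z + t *\<^sub>R h) + ((z + t *\<^sub>R h) \<bullet> e) * P' (z + t *\<^sub>R h)) (at t)" for z t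
    unfolding inner_add_left inner_scaleR_left
    by (rule derivative_eq_intros P' refl | simp add: algebra_simps)+
  ultimately show ?case by blast
qed

context separated_source
begin

text \<open>
  The derivative of \<open>P(z) exp(-\<bar>z\<bar>\<^sup>2)\<close> in direction \<open>h\<close> is \<open>(\<partial>\<^sub>h P - 2 (z \<bullet> h) P) exp(-\<bar>z\<bar>\<^sup>2)\<close>. If \<open>P\<close> and \<open>\<partial>\<^sub>h P\<close>
  have degree at most \<open>m\<close>, this expresses the kernel with the polynomial \<open>(z \<bullet> h) P\<close> of degree \<open>m + 1\<close>
  by annihilated ones.
\<close>

lemma annihilates_poly_gaussian:
  assumes "annihilates (\<lambda>z. exp (- (z \<bullet> z)))" and "poly_le m P"
  shows "annihilates (\<lambda>z. P z * exp (- (z \<bullet> z)))"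
  using assms(2)
proof (induction m arbitrary: P)
  have cont: "continuous_on (- {0}) (\<lambda>z. P z * exp (- (z \<bullet> z)))" if "poly_le m P" for m P
    using poly_le_continuous[OF that] by (intro continuous_intros)
  have const_case: "annihilates (\<lambda>z. c * exp (- (z \<bullet> z)))" for c
    by (rule annihilates_scale[OF assms(1)])
  have add_case: "annihilates (\<lambda>z. (P z + Q z) * exp (- (z \<bullet> z)))"
    if "poly_le m P" "poly_le m Q" "annihilates (\<lambda>z. P z * exp (- (z \<bullet> z)))"
      "annihilates (\<lambda>z. Q z * exp (- (z \<bullet> z)))" for m P Q
    using annihilates_add[OF cont[OF that(1)] cont[OF that(2)] that(3,4)] by (simp add: distrib_right)
  {
    case 0
    from 0 show ?case
      by (induction "0::nat" P rule: poly_le.induct) (auto intro: const_case add_case)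
  next
    case (Suc m)
    from Suc.prems show ?case
    proof (induction "Suc m" P rule: poly_le.induct)
      case (times P h)
      obtain P' where P': "poly_le m P'"
        "\<And>z t. ((\<lambda>t. P (z + t *\<^sub>R h)) has_real_derivative P' (z + t *\<^sub>R h)) (at t)"
        using poly_le_directional_derivative[OF times(1)] by blast
      define D where "D z = P' z * exp (- (z \<bullet> z)) + 2 * ((z \<bullet> h) * P z) * - exp (- (z \<bullet> z))" for z
      have contD: "continuous_on (- {0}) D"
        unfolding D_def using poly_le_continuous[OF times(1)] poly_le_continuous[OF P'(1)]
        by (intro continuous_intros)
      have "annihilates D"
      proof (rule annihilates_directional_derivative[OF cont[OF times(1)] contD Suc.IH[OF times(1)]])
        fix z t
        have "((\<lambda>u. exp (- u)) has_real_derivative - exp (- u)) (at u)" for u :: real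
          by (rule derivative_eq_intros refl | simp)+
        from radial_directional_derivative[OF P'(2) this]
        show "((\<lambda>t. P (z + t *\<^sub>R h) * exp (- ((z + t *\<^sub>R h) \<bullet> (z + t *\<^sub>R h)))) has_real_derivative
          D (z + t *\<^sub>R h)) (at t)" unfolding D_def .
      qed
      hence "annihilates (\<lambda>z. (1/2) * (P' z * exp (- (z \<bullet> z)) + (-1) * D z))"
        using contD by (intro annihilates_scale annihilates_add cont[OF P'(1)] Suc.IH[OF P'(1)] continuous_intros)
      thus ?case by (rule annihilates_cong) (simp add: D_def)
    qed (auto intro: const_case add_case)
  }
qed

text \<open>
  Unique continuation for Riesz potentials. The second condition on \<open>a\<close> keeps every Laplacian of
  \<open>\<bar>z\<bar>\<^bsup>-2(a + j)\<^esup>\<close> nonzero. It excludes, for instance, the Newton kernel \<open>a = N/2 - 1\<close>, \<open>N \<ge> 3\<close>, whose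
  potential vanishes outside a ball for every radial density of total mass zero in that ball.
\<close>

lemma source_AE_eq_0:
  assumes ne: "B \<noteq> {}" and a: "a > 0" "2 * (a + 1) > real DIM('a)"
    and ann: "annihilates (riesz_kernel a)"
  shows "AE y in lebesgue. g y = 0"
proof -
  \<comment> \<open>A single observer is enough from here on.\<close>
  obtain x where x: "x \<in> B" using ne by blast
  define G where "G y = g y * exp (- ((y - x) \<bullet> (y - x)))" for y
  have gauss: "annihilates (\<lambda>z. exp (- (z \<bullet> z)))"
    by (intro annihilates_gaussian[of a] annihilates_riesz_kernel_add a ann)
  have "AE y in lebesgue. G y = 0"
  proof (rule AE_eq_0_if_polynomial_moments_vanish)
    show "integrable lebesgue G"
      unfolding G_def by (rule kernel_integrable[OF _ x]) (intro continuous_intros)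
    show "bounded {y. G y \<noteq> 0}"
      using bounded_source by (simp add: G_def)
    show "(LINT y|lebesgue. G y * Q y) = 0" if Q: "real_polynomial_function Q" for Q
    proof -
      have "real_polynomial_function (\<lambda>z. Q (z + x))"
        using Q by (intro real_polynomial_function_compose[of "\<lambda>z. z + x" Q, unfolded o_def]
          polynomial_function_add polynomial_function_id polynomial_function_const)
      then obtain m where "poly_le m (\<lambda>z. Q (z + x))"
        using real_polynomial_function_imp_poly_le by blast
      from annihilates_poly_gaussian[OF gauss this] x
      have "(LINT y|lebesgue. g y * (Q (y - x + x) * exp (- ((y - x) \<bullet> (y - x))))) = 0"
        unfolding annihilates_def by blast
      thus ?thesis by (simp add: G_def mult.assoc mult.commute[of "Q _"])
    qed
  qed
  thus ?thesis by (simp add: G_def)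
qed

end

section \<open>The nonlocal normal derivative\<close>

lemma L2_imp_integrable:
  assumes "f \<in> L2 \<Omega>" "\<Omega> \<in> lmeasurable"
  shows "set_integrable lebesgue \<Omega> f"
proof -
  have m: "set_borel_measurable lebesgue \<Omega> f" and sq: "set_integrable lebesgue \<Omega> (\<lambda>x. (f x)\<^sup>2)"
    using assms by (auto simp: L2_def)
  have "integrable lebesgue (\<lambda>x. indicator \<Omega> x + indicator \<Omega> x * (f x)\<^sup>2)"
    using sq assms(2) by (intro Bochner_Integration.integrable_add)
      (auto simp: set_integrable_def fmeasurable_def)
  thus ?thesis
    unfolding set_integrable_def
  proof (rule Bochner_Integration.integrable_bound)
    show "(\<lambda>x. indicat_real \<Omega> x *\<^sub>R f x) \<in> borel_measurable lebesgue"
      using m by (simp add: set_borel_measurable_def)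
    show "AE x in lebesgue. norm (indicat_real \<Omega> x *\<^sub>R f x)
        \<le> norm (indicat_real \<Omega> x + indicat_real \<Omega> x * (f x)\<^sup>2)"
    proof (rule AE_I2)
      fix x
      have "\<bar>f x\<bar> \<le> 1 + (f x)\<^sup>2"
        using sum_squares_bound[of "\<bar>f x\<bar>" 1] by simp
      thus "norm (indicat_real \<Omega> x *\<^sub>R f x) \<le> norm (indicat_real \<Omega> x + indicat_real \<Omega> x * (f x)\<^sup>2)"
        by (simp add: indicator_def)
    qed
  qed
qed

lemma frac_const_nonzero:
  assumes "0 < s" "s < 1"
  shows "frac_const TYPE('a::euclidean_space) s \<noteq> 0"
proof -
  have "Gamma ((2 * s + real DIM('a)) / 2) > 0" "Gamma (1 - s) > 0"
    using assms by (auto intro!: Gamma_real_pos divide_pos_pos add_pos_nonneg)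
  hence "frac_const TYPE('a) s > 0"
    using assms unfolding frac_const_def by (intro divide_pos_pos mult_pos_pos) auto
  thus ?thesis by simp
qed

text \<open>
  On \<open>Obs\<close> the term \<open>f x\<close> in the integrand of the normal derivative vanishes, which leaves the Riesz
  potential with exponent \<open>a = N/2 + s\<close> of \<open>f\<close> restricted to \<open>\<Omega>\<close>. As \<open>2(a + 1) - N = 2s + 2\<close> is positive,
  unique continuation applies.
\<close>

lemma unique_continuation_nonlocal_normal:
  fixes \<Omega> Obs :: "'a::euclidean_space set"
  assumes \<Omega>: "open \<Omega>" "bounded \<Omega>" and s: "0 < s" "s < 1"
    and f: "f \<in> L2 \<Omega>" "AE x in lebesgue. x \<notin> \<Omega> \<longrightarrow> f x = 0"
    and Obs: "open Obs" "Obs \<noteq> {}" "Obs \<subseteq> - \<Omega>"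
    and normal: "AE x in lebesgue. x \<in> Obs \<longrightarrow> nonlocal_normal s \<Omega> f x = 0"
  shows "AE x in lebesgue. x \<in> \<Omega> \<longrightarrow> f x = 0"
proof -
  define g where "g x = indicat_real \<Omega> x * f x" for x
  have "set_integrable lebesgue \<Omega> f"
    using f(1) \<Omega> by (intro L2_imp_integrable lmeasurable_open)
  hence g: "integrable lebesgue g" by (simp add: set_integrable_def g_def[abs_def])
  interpret separated_source g Obs
  proof
    show "integrable lebesgue g" by (fact g)
    show "bounded {y. g y \<noteq> 0}"
      by (rule bounded_subset[OF \<Omega>(2)]) (auto simp: g_def indicator_def)
    show "open Obs" by fact
    show "g x = 0" if "x \<in> Obs" for x using that Obs(3) by (auto simp: g_def)
  qed
  define a where "a = real DIM('a) / 2 + s"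
  have kernel: "frac_kernel s x y = riesz_kernel a (y - x)" for x y :: 'a
  proof (cases "x = y")
    case False
    have "norm (x - y) powr (real DIM('a) + 2 * s) = norm (x - y) powr (2 * a)"
      by (simp add: a_def distrib_left)
    also have "\<dots> = ((norm (x - y)) powr 2) powr a"
      by (simp only: powr_powr)
    also have "(norm (x - y)) powr 2 = (y - x) \<bullet> (y - x)"
      by (simp add: power2_norm_eq_inner[symmetric] norm_minus_commute)
    finally show ?thesis by (simp add: frac_kernel_def powr_minus_divide)
  qed (simp add: frac_kernel_def)
  have "AE x in lebesgue. x \<in> Obs \<longrightarrow> (LINT y|lebesgue. g y * riesz_kernel a (y - x)) = 0"
    using f(2) normal
  proof eventually_elim
    case (elim x)
    show ?case
    proof
      assume x: "x \<in> Obs"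
      hence fx: "f x = 0" using elim(1) Obs(3) by blast
      have "(LINT y:\<Omega>|lebesgue. (f x - f y) * frac_kernel s x y) = 0"
        using elim(2) x frac_const_nonzero[OF s, where 'a = 'a] by (simp add: nonlocal_normal_def)
      also have "(LINT y:\<Omega>|lebesgue. (f x - f y) * frac_kernel s x y)
          = (LINT y|lebesgue. - (g y * riesz_kernel a (y - x)))"
        unfolding set_lebesgue_integral_def fx kernel by (simp add: g_def mult.assoc)
      finally show "(LINT y|lebesgue. g y * riesz_kernel a (y - x)) = 0" by simp
    qed
  qed
  hence "annihilates (riesz_kernel a)"
    by (rule annihilates_if_AE[rotated]) (intro continuous_intros, auto)
  moreover have "a > 0" "2 * (a + 1) > real DIM('a)" using s by (auto simp: a_def add_nonneg_pos)
  ultimately have "AE y in lebesgue. g y = 0"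
    using source_AE_eq_0 Obs(2) by blast
  thus ?thesis by (auto simp: g_def elim: eventually_mono)
qed

theorem theorem2p5:
  fixes \<Omega> Obs :: "'a::euclidean_space set"
    and s \<alpha> T :: real
    and u0 :: "'a \<Rightarrow> real"
    and v :: "real \<Rightarrow> 'a \<Rightarrow> real"
  assumes "open \<Omega>" and "connected \<Omega>" and "\<Omega> \<noteq> {}" and "bounded \<Omega>"
    and "lipschitz_boundary \<Omega>"
    and "0 < s" and "s < 1"
    and "0 < \<alpha>" and "\<alpha> \<le> 1"
    and "0 < T"
    and "u0 \<in> L2 \<Omega>"
    and "strong_solution s \<alpha> T \<Omega> u0 v"
    and "open Obs" and "Obs \<noteq> {}" and "Obs \<subseteq> - \<Omega>"
    and "\<forall>t\<in>{0<..<T}. AE x in lebesgue. x \<in> Obs \<longrightarrow> nonlocal_normal s \<Omega> (v t) x = 0"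
  shows "\<forall>t\<in>{0<..<T}. AE x in lebesgue. x \<in> \<Omega> \<longrightarrow> v t x = 0"
proof
  fix t assume t: "t \<in> {0<..<T}"
  have "v t \<in> L2 \<Omega>" "AE x in lebesgue. x \<notin> \<Omega> \<longrightarrow> v t x = 0"
    using assms(12) t unfolding strong_solution_def by blast+
  thus "AE x in lebesgue. x \<in> \<Omega> \<longrightarrow> v t x = 0"
    using assms t by (intro unique_continuation_nonlocal_normal[of \<Omega> s "v t" Obs]) auto
qed

end
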